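(* Let $i\in\{1,2\}$, $\varepsilon=(-1)^i$, and let $\mathcal{S}_i$ be the timelike general rotational surface of first type ($i=1$) or second type ($i=2$) determined by $f,g,\alpha,\beta$. Let $\lambda_1,\lambda_2,\lambda_3,\lambda_4\in\mathbb{R}$ be not all zero, put $\delta=\lambda_1+\lambda_2+\lambda_3-\lambda_4$, and equip $\mathbb{E}_1^4$ with the density $e^{\lambda_1x^2+\lambda_2y^2+\lambda_3z^2+\lambda_4t^2}$. Then $\mathcal{S}_i$ is weighted flat if and only if $$\begin{aligned}&-2\delta\left((\alpha f)^2+\varepsilon(\beta g)^2\right)^2\left(-\varepsilon f'^2+g'^2\right)^2+\alpha^2\beta^2\left(gf'-fg'\right)^2\left(-\varepsilon f'^2+g'^2\right)\\&\quad+\left(\varepsilon(\alpha f)^2+(\beta g)^2\right)\left(\beta^2gf'+\alpha^2fg'\right)\left(f''g'-f'g''\right)=0\end{aligned}$$ holds (for all $u\in J$).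
   Context: $\mathbb{E}_1^4$ is $\mathbb{R}^4$ with coordinates $(x,y,z,t)$ and the metric $dx^2+dy^2+dz^2-dt^2$. Let $\alpha,\beta>0$ be constants, $J\subset\mathbb{R}$ an open interval, $f,g:J\to\mathbb{R}$ smooth functions of $u$ (primes denote $d/du$), and $v\in[0,2\pi)$. First type: $\mathcal{S}_1: X_1(u,v)=(f\cos(\alpha v),f\sin(\alpha v),g\cosh(\beta v),g\sinh(\beta v))$ with $\alpha^2f^2-\beta^2g^2<0$ and $f'^2+g'^2>0$ on $J$. Second type: $\mathcal{S}_2: X_2(u,v)=(f\cos(\alpha v),f\sin(\alpha v),g\sinh(\beta v),g\cosh(\beta v))$ with $f'^2-g'^2<0$ and $\alpha^2f^2+\beta^2g^2>0$ on $J$. Both surfaces are timelike. With $\varepsilon=(-1)^i$, the Gaussian curvature of $\mathcal{S}_i$ is $$K^{\mathcal{S}_i}=\frac{\alpha^2\beta^2(gf'-fg')^2(-\varepsilon f'^2+g'^2)+\left(\varepsilon(\alpha f)^2+(\beta g)^2\right)(\alpha^2fg'+\beta^2gf')(f''g'-f'g'')}{\left((\alpha f)^2+\varepsilon(\beta g)^2\right)^2(-\varepsilon f'^2+g'^2)^2}.$$ For a density $e^\phi$ on $\mathbb{E}_1^4$, the weighted Gaussian curvature is $K_\phi^{\mathcal{S}_i}=K^{\mathcal{S}_i}-\Delta\phi$, where $\Delta$ is the Laplacian of $\mathbb{E}_1^4$, $\Delta\phi=\phi_{xx}+\phi_{yy}+\phi_{zz}-\phi_{tt}$. The surface is weighted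 flat if $K_\phi^{\mathcal{S}_i}$ vanishes identically. *)

theory Defs
  imports "HOL-Analysis.Analysis"
begin

text \<open>
  The space \<open>\<bbbE>\<^sub>1\<^sup>4\<close> is \<open>real^4\<close> with the product \<open>lorentz\<close>; its coordinates
  \<open>(x, y, z, t)\<close> are the components 1, 2, 3, 4 of a vector.
\<close>

definition lorentz :: "real^4 \<Rightarrow> real^4 \<Rightarrow> real" where
  "lorentz p q = p$1 * q$1 + p$2 * q$2 + p$3 * q$3 - p$4 * q$4"

definition partial :: "4 \<Rightarrow> (real^4 \<Rightarrow> real) \<Rightarrow> real^4 \<Rightarrow> real" where
  "partial k \<phi> p = deriv (\<lambda>s. \<phi> (p + s *\<^sub>R axis k 1)) 0"

definition laplacian :: "(real^4 \<Rightarrow> real) \<Rightarrow> real^4 \<Rightarrow> real" where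
  "laplacian \<phi> p =
     partial 1 (partial 1 \<phi>) p + partial 2 (partial 2 \<phi>) p
     + partial 3 (partial 3 \<phi>) p - partial 4 (partial 4 \<phi>) p"

type_synonym surface = "real \<Rightarrow> real \<Rightarrow> real^4"

definition du :: "surface \<Rightarrow> surface" where
  "du X u v = vector_derivative (\<lambda>s. X s v) (at u)"

definition dv :: "surface \<Rightarrow> surface" where
  "dv X u v = vector_derivative (\<lambda>s. X u s) (at v)"

definition coeffE :: "surface \<Rightarrow> real \<Rightarrow> real \<Rightarrow> real" where
  "coeffE X u v = lorentz (du X u v) (du X u v)"

definition coeffF :: "surface \<Rightarrow> real \<Rightarrow> real \<Rightarrow> real" where
  "coeffF X u v = lorentz (du X u v) (dv X u v)"

definition coeffG :: "surface \<Rightarrow> real \<Rightarrow> real \<Rightarrow> real" where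
  "coeffG X u v = lorentz (dv X u v) (dv X u v)"

definition gram :: "surface \<Rightarrow> real \<Rightarrow> real \<Rightarrow> real" where
  "gram X u v = coeffE X u v * coeffG X u v - (coeffF X u v)\<^sup>2"

text \<open>
  The component of \<open>w\<close> that is \<open>lorentz\<close>-orthogonal to the tangent plane.
  The tangential component \<open>a X\<^sub>u + b X\<^sub>v\<close> comes from inverting the matrix of the
  first fundamental form, which requires \<open>gram X u v \<noteq> 0\<close>.
\<close>

definition normal_part :: "surface \<Rightarrow> real \<Rightarrow> real \<Rightarrow> real^4 \<Rightarrow> real^4" where
  "normal_part X u v w =
     (let E = coeffE X u v; F = coeffF X u v; G = coeffG X u v;
          p = lorentz w (du X u v); q = lorentz w (dv X u v);
          a = (p * G - q * F) / gram X u v;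
          b = (q * E - p * F) / gram X u v
      in w - a *\<^sub>R du X u v - b *\<^sub>R dv X u v)"

text \<open>
  Gauss equation in a flat ambient space, with \<open>h\<close> the vector-valued second fundamental
  form. For an orthonormal normal frame \<open>n\<^sub>3, n\<^sub>4\<close> with \<open>\<langle>n\<^sub>k, n\<^sub>k\<rangle> = \<epsilon>\<^sub>k\<close> and
  \<open>h\<^sup>k\<^sub>i\<^sub>j = \<langle>h\<^sub>i\<^sub>j, n\<^sub>k\<rangle>\<close>, the numerator is the sum over \<open>k\<close> of
  \<open>\<epsilon>\<^sub>k (h\<^sup>k\<^sub>1\<^sub>1 h\<^sup>k\<^sub>2\<^sub>2 - (h\<^sup>k\<^sub>1\<^sub>2)\<^sup>2)\<close>.
\<close>

definition gaussian_curvature :: "surface \<Rightarrow> real \<Rightarrow> real \<Rightarrow> real" where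
  "gaussian_curvature X u v =
     (let h11 = normal_part X u v (du (du X) u v);
          h12 = normal_part X u v (dv (du X) u v);
          h22 = normal_part X u v (dv (dv X) u v)
      in (lorentz h11 h22 - lorentz h12 h12) / gram X u v)"

text \<open>Here and below, \<open>\<phi>\<close> is the exponent of the density \<open>e\<^sup>\<phi>\<close>.\<close>

definition weighted_gaussian_curvature ::
    "(real^4 \<Rightarrow> real) \<Rightarrow> surface \<Rightarrow> real \<Rightarrow> real \<Rightarrow> real" where
  "weighted_gaussian_curvature \<phi> X u v = gaussian_curvature X u v - laplacian \<phi> (X u v)"

definition weighted_flat :: "(real^4 \<Rightarrow> real) \<Rightarrow> surface \<Rightarrow> (real \<times> real) set \<Rightarrow> bool" where
  "weighted_flat \<phi> X D \<longleftrightarrow> (\<forall>(u, v) \<in> D. weighted_gaussian_curvature \<phi> X u v = 0)"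

definition smooth_on :: "(real \<Rightarrow> real) \<Rightarrow> real set \<Rightarrow> bool" where
  "smooth_on f J \<longleftrightarrow> (\<forall>n. \<forall>u\<in>J. (deriv ^^ n) f differentiable (at u))"

text \<open>
  The index \<open>i\<close> is the type of the surface, 1 or 2. The formulas make sense for every real
  \<open>v\<close>; thus the derivatives in direction \<open>v\<close> are two-sided also at \<open>v = 0\<close>.
\<close>

definition rotational_surface ::
    "nat \<Rightarrow> real \<Rightarrow> real \<Rightarrow> (real \<Rightarrow> real) \<Rightarrow> (real \<Rightarrow> real) \<Rightarrow> surface" where
  "rotational_surface i \<alpha> \<beta> f g u v =
     (if i = 1
      then vector [f u * cos (\<alpha> * v), f u * sin (\<alpha> * v), g u * cosh (\<beta> * v), g u * sinh (\<beta> * v)]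
      else vector [f u * cos (\<alpha> * v), f u * sin (\<alpha> * v), g u * sinh (\<beta> * v), g u * cosh (\<beta> * v)])"

text \<open>These inequalities say that \<open>E\<close> and \<open>G\<close> have opposite signs, so that (as \<open>F = 0\<close>)
  the surface is timelike.\<close>

definition timelike_condition ::
    "nat \<Rightarrow> real \<Rightarrow> real \<Rightarrow> (real \<Rightarrow> real) \<Rightarrow> (real \<Rightarrow> real) \<Rightarrow> real set \<Rightarrow> bool" where
  "timelike_condition i \<alpha> \<beta> f g J \<longleftrightarrow>
     (\<forall>u\<in>J. if i = 1
        then \<alpha>\<^sup>2 * (f u)\<^sup>2 - \<beta>\<^sup>2 * (g u)\<^sup>2 < 0 \<and> (deriv f u)\<^sup>2 + (deriv g u)\<^sup>2 > 0
        else (deriv f u)\<^sup>2 - (deriv g u)\<^sup>2 < 0 \<and> \<alpha>\<^sup>2 * (f u)\<^sup>2 + \<beta>\<^sup>2 * (g u)\<^sup>2 > 0)"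

end

theory Submission
  imports Defs
begin

text \<open>
  Both types of surface have the form \<open>X(u,v) = f(u) e(v) + g(u) h(v)\<close>, where \<open>e\<close> runs
  through the unit circle of the \<open>xy\<close>-plane and \<open>h\<close> through a unit hyperbola of the
  \<open>zt\<close>-plane. Together with \<open>e' / \<alpha>\<close> and \<open>h' / \<beta>\<close> they form a frame that is orthonormal for the
  Lorentz product, and differentiating this frame in \<open>v\<close> only permutes it up to factors
  (\<open>e'' = -\<alpha>\<^sup>2 e\<close>, \<open>h'' = \<beta>\<^sup>2 h\<close>). The two types differ only in the causal character of \<open>h\<close>, that
  is in \<open>\<langle>h, h\<rangle> = -\<epsilon>\<close>. Hence all scalar products of the derivatives of \<open>X\<close>, of first and
  second order, can be read off from the frame, do not depend on \<open>v\<close>, and are polynomials in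
  \<open>\<epsilon>, \<alpha>, \<beta>\<close>, in \<open>f, g\<close> and in their derivatives.

  In particular \<open>F = 0\<close>, so that \<open>X\<^sub>u, X\<^sub>v\<close> is an orthogonal basis of the tangent plane, and
  the Gauss equation gives \<open>K\<close> by subtracting two orthogonal projections from each product
  of second derivatives (lemma \<open>gaussian_curvature_orthogonal\<close>). Multiplying by \<open>(E G)\<^sup>2\<close> clears
  the denominators and leaves the polynomial of lemma \<open>curvature_times_gram_squared\<close>.

  On the other side, the Laplacian of a quadratic form in diagonal shape is the constant
  \<open>2 (\<lambda>\<^sub>1 + \<lambda>\<^sub>2 + \<lambda>\<^sub>3 - \<lambda>\<^sub>4) = 2 \<delta>\<close>. As the timelike condition makes \<open>E G\<close> nonzero, \<open>K = 2 \<delta>\<close> is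
  equivalent to \<open>K (E G)\<^sup>2 - 2 \<delta> (E G)\<^sup>2 = 0\<close>, which is the stated differential equation.
\<close>


section \<open>The Laplacian of a diagonal quadratic form\<close>

lemma partial_diagonal_quadratic:
  fixes c :: "4 \<Rightarrow> real"
  shows "partial k (\<lambda>p. \<Sum>j\<in>UNIV. c j * (p$j)\<^sup>2) = (\<lambda>p. 2 * c k * p$k)"
proof
  fix p :: "real^4"
  have "((\<lambda>s. \<Sum>j\<in>UNIV. c j * ((p + s *\<^sub>R axis k 1)$j)\<^sup>2) has_real_derivative
          (\<Sum>j\<in>UNIV. if j = k then 2 * c k * p$k else 0)) (at 0)"
    by (rule DERIV_sum) (auto intro!: derivative_eq_intros simp: axis_def)
  then show "partial k (\<lambda>p. \<Sum>j\<in>UNIV. c j * (p$j)\<^sup>2) p = 2 * c k * p$k"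
    unfolding partial_def by (simp add: DERIV_imp_deriv)
qed

lemma partial_linear: "partial k (\<lambda>p. a * p$k) p = a"
proof -
  have "((\<lambda>s. a * (p + s *\<^sub>R axis k 1)$k) has_real_derivative a) (at 0)"
    by (auto intro!: derivative_eq_intros simp: axis_def)
  then show ?thesis
    unfolding partial_def by (simp add: DERIV_imp_deriv)
qed

lemma laplacian_diagonal_quadratic:
  "laplacian (\<lambda>p. l1 * (p$1)\<^sup>2 + l2 * (p$2)\<^sup>2 + l3 * (p$3)\<^sup>2 + l4 * (p$4)\<^sup>2) p
     = 2 * (l1 + l2 + l3 - l4)"
proof -
  define c :: "4 \<Rightarrow> real"
    where "c j = (if j = 1 then l1 else if j = 2 then l2 else if j = 3 then l3 else l4)" for j
  have c: "c 1 = l1" "c 2 = l2" "c 3 = l3" "c 4 = l4"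
    by (auto simp: c_def)
  have "(\<lambda>p::real^4. l1 * (p$1)\<^sup>2 + l2 * (p$2)\<^sup>2 + l3 * (p$3)\<^sup>2 + l4 * (p$4)\<^sup>2)
      = (\<lambda>p. \<Sum>j\<in>UNIV. c j * (p$j)\<^sup>2)"
    by (simp add: sum_4 c)
  then show ?thesis
    unfolding laplacian_def
    by (simp add: partial_diagonal_quadratic partial_linear c del: mult_cancel_left)
qed


section \<open>The Gauss equation in orthogonal parameters\<close>

lemma lorentz_add_left: "lorentz (p + q) r = lorentz p r + lorentz q r"
  and lorentz_add_right: "lorentz r (p + q) = lorentz r p + lorentz r q"
  and lorentz_diff_left: "lorentz (p - q) r = lorentz p r - lorentz q r"
  and lorentz_diff_right: "lorentz r (p - q) = lorentz r p - lorentz r q"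
  and lorentz_scaleR_left: "lorentz (a *\<^sub>R p) r = a * lorentz p r"
  and lorentz_scaleR_right: "lorentz r (a *\<^sub>R p) = a * lorentz r p"
  by (simp_all add: lorentz_def algebra_simps)

lemma lorentz_commute: "lorentz p q = lorentz q p"
  by (simp add: lorentz_def mult.commute)

lemmas lorentz_bilinear =
  lorentz_add_left lorentz_add_right lorentz_diff_left lorentz_diff_right
  lorentz_scaleR_left lorentz_scaleR_right

text \<open>
  With \<open>F = 0\<close> the first fundamental form is diagonal, so taking the normal part subtracts the
  projections to \<open>X\<^sub>u\<close> and \<open>X\<^sub>v\<close> separately, and each projection is self-adjoint.
\<close>

lemma lorentz_normal_parts_orthogonal:
  assumes "coeffF X u v = 0" and "coeffE X u v \<noteq> 0" and "coeffG X u v \<noteq> 0"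
  shows "lorentz (normal_part X u v w) (normal_part X u v w') =
           lorentz w w'
           - lorentz w (du X u v) * lorentz w' (du X u v) / coeffE X u v
           - lorentz w (dv X u v) * lorentz w' (dv X u v) / coeffG X u v"
proof -
  have normal: "normal_part X u v z =
      z - (lorentz z (du X u v) / coeffE X u v) *\<^sub>R du X u v
        - (lorentz z (dv X u v) / coeffG X u v) *\<^sub>R dv X u v" for z
    using assms by (simp add: normal_part_def gram_def Let_def)
  have products:
    "lorentz (du X u v) (du X u v) = coeffE X u v"
    "lorentz (du X u v) (dv X u v) = 0" "lorentz (dv X u v) (du X u v) = 0"
    "lorentz (dv X u v) (dv X u v) = coeffG X u v"
    "lorentz (du X u v) w' = lorentz w' (du X u v)"
    "lorentz (dv X u v) w' = lorentz w' (dv X u v)"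
    using assms(1) by (simp_all add: coeffE_def coeffF_def coeffG_def lorentz_commute)
  show ?thesis
    unfolding normal lorentz_bilinear products
    using assms(2,3) by (simp add: field_simps)
qed

text \<open>
  The curvature is scaled by the square of the Gram determinant: one factor cancels the
  denominator in the Gauss equation, the other one the denominators \<open>E\<close> and \<open>G\<close> of the
  projections.
\<close>

lemma gaussian_curvature_orthogonal:
  assumes "coeffF X u v = 0" and "coeffE X u v \<noteq> 0" and "coeffG X u v \<noteq> 0"
  shows "gaussian_curvature X u v * (coeffE X u v * coeffG X u v)\<^sup>2 =
           (lorentz (du (du X) u v) (dv (dv X) u v) - lorentz (dv (du X) u v) (dv (du X) u v))
             * (coeffE X u v * coeffG X u v)
           - (lorentz (du (du X) u v) (du X u v) * lorentz (dv (dv X) u v) (du X u v)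
              - (lorentz (dv (du X) u v) (du X u v))\<^sup>2) * coeffG X u v
           - (lorentz (du (du X) u v) (dv X u v) * lorentz (dv (dv X) u v) (dv X u v)
              - (lorentz (dv (du X) u v) (dv X u v))\<^sup>2) * coeffE X u v"
proof -
  have clear: "((p - a * a' / E - b * b' / G) - (q - c * c / E - d * d / G)) * (E * G) =
      (p - q) * (E * G) - (a * a' - c\<^sup>2) * G - (b * b' - d\<^sup>2) * E"
    if "E \<noteq> 0" "G \<noteq> 0" for p q a a' b b' c d E G :: real
    using that by (simp add: algebra_simps power2_eq_square)
  have "gaussian_curvature X u v * (coeffE X u v * coeffG X u v)\<^sup>2 =
      (lorentz (normal_part X u v (du (du X) u v)) (normal_part X u v (dv (dv X) u v))
       - lorentz (normal_part X u v (dv (du X) u v)) (normal_part X u v (dv (du X) u v)))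
      * (coeffE X u v * coeffG X u v)"
    using assms by (simp add: gaussian_curvature_def gram_def Let_def power2_eq_square)
  then show ?thesis
    by (simp only: lorentz_normal_parts_orthogonal[OF assms] clear[OF assms(2,3)])
qed


section \<open>Surfaces swept out by a circle and a hyperbola\<close>

text \<open>
  The vector \<open>e1 v\<close> traces a unit circle with angular velocity \<open>\<alpha>\<close>, the vector \<open>h1 v\<close> a unit
  hyperbola with hyperbolic angular velocity \<open>\<beta>\<close>, and \<open>e2\<close>, \<open>h2\<close> are their unit tangents.
  The sign \<open>\<epsilon>\<close> tells whether \<open>h1\<close> is spacelike (\<open>\<epsilon> = -1\<close>) or timelike (\<open>\<epsilon> = 1\<close>).
\<close>

locale rotating_frame =
  fixes \<epsilon> \<alpha> \<beta> :: real and e1 e2 h1 h2 :: "real \<Rightarrow> real^4"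
  assumes sign_squared: "\<epsilon>\<^sup>2 = 1"
    and e1_deriv: "(e1 has_vector_derivative \<alpha> *\<^sub>R e2 v) (at v)"
    and e2_deriv: "(e2 has_vector_derivative (- \<alpha>) *\<^sub>R e1 v) (at v)"
    and h1_deriv: "(h1 has_vector_derivative \<beta> *\<^sub>R h2 v) (at v)"
    and h2_deriv: "(h2 has_vector_derivative \<beta> *\<^sub>R h1 v) (at v)"
    and e_products:
      "lorentz (e1 v) (e1 v) = 1" "lorentz (e2 v) (e2 v) = 1" "lorentz (e1 v) (e2 v) = 0"
    and h_products:
      "lorentz (h1 v) (h1 v) = - \<epsilon>" "lorentz (h2 v) (h2 v) = \<epsilon>" "lorentz (h1 v) (h2 v) = 0"
    and mixed_products:
      "lorentz (e1 v) (h1 v) = 0" "lorentz (e1 v) (h2 v) = 0"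
      "lorentz (e2 v) (h1 v) = 0" "lorentz (e2 v) (h2 v) = 0"
begin

definition swept :: "(real \<Rightarrow> real) \<Rightarrow> (real \<Rightarrow> real) \<Rightarrow> surface" where
  "swept f g u v = f u *\<^sub>R e1 v + g u *\<^sub>R h1 v"

lemma frame_products:
  "lorentz (e1 v) (e1 v) = 1" "lorentz (e2 v) (e2 v) = 1"
  "lorentz (e1 v) (e2 v) = 0" "lorentz (e2 v) (e1 v) = 0"
  "lorentz (h1 v) (h1 v) = - \<epsilon>" "lorentz (h2 v) (h2 v) = \<epsilon>"
  "lorentz (h1 v) (h2 v) = 0" "lorentz (h2 v) (h1 v) = 0"
  "lorentz (e1 v) (h1 v) = 0" "lorentz (h1 v) (e1 v) = 0"
  "lorentz (e1 v) (h2 v) = 0" "lorentz (h2 v) (e1 v) = 0"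
  "lorentz (e2 v) (h1 v) = 0" "lorentz (h1 v) (e2 v) = 0"
  "lorentz (e2 v) (h2 v) = 0" "lorentz (h2 v) (e2 v) = 0"
  using e_products[of v] h_products[of v] mixed_products[of v] by (simp_all add: lorentz_commute)

lemma vector_derivative_scaleR_add:
  fixes p q :: "real^4"
  assumes "(a has_real_derivative a') (at u)" and "(b has_real_derivative b') (at u)"
  shows "vector_derivative (\<lambda>s. a s *\<^sub>R p + b s *\<^sub>R q) (at u) = a' *\<^sub>R p + b' *\<^sub>R q"
  by (rule vector_derivative_at) (auto intro!: derivative_eq_intros assms)

lemma du_swept:
  assumes "f differentiable (at u)" and "g differentiable (at u)"
  shows "du (swept f g) u v = deriv f u *\<^sub>R e1 v + deriv g u *\<^sub>R h1 v"
  unfolding du_def swept_def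
  using assms by (intro vector_derivative_scaleR_add) (simp_all add: DERIV_deriv_iff_real_differentiable)

lemma dv_swept: "dv (swept f g) u v = (\<alpha> * f u) *\<^sub>R e2 v + (\<beta> * g u) *\<^sub>R h2 v"
  unfolding dv_def swept_def
  by (rule vector_derivative_at)
    (auto intro!: derivative_eq_intros e1_deriv h1_deriv simp: algebra_simps)

lemma dv_dv_swept:
  "dv (dv (swept f g)) u v = (- \<alpha>\<^sup>2 * f u) *\<^sub>R e1 v + (\<beta>\<^sup>2 * g u) *\<^sub>R h1 v"
  unfolding dv_def[of "dv (swept f g)"] dv_swept
  by (rule vector_derivative_at)
    (auto intro!: derivative_eq_intros e2_deriv h2_deriv simp: algebra_simps power2_eq_square)

lemma dv_du_swept:
  assumes "f differentiable (at u)" and "g differentiable (at u)"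
  shows "dv (du (swept f g)) u v = (\<alpha> * deriv f u) *\<^sub>R e2 v + (\<beta> * deriv g u) *\<^sub>R h2 v"
proof -
  have "dv (du (swept f g)) u v = dv (swept (deriv f) (deriv g)) u v"
    by (simp add: dv_def[of "du (swept f g)"] dv_def[of "swept (deriv f) (deriv g)"]
        du_swept[OF assms] swept_def[of "deriv f" "deriv g"])
  then show ?thesis
    by (simp add: dv_swept)
qed

text \<open>
  The formula for \<open>X\<^sub>u\<close> must hold on a neighbourhood of \<open>u\<close> in order to be differentiated once more;
  this is where \<open>J\<close> has to be open.
\<close>

lemma du_du_swept:
  assumes J: "open J" "u \<in> J" and "smooth_on f J" and "smooth_on g J"
  shows "du (du (swept f g)) u v = deriv (deriv f) u *\<^sub>R e1 v + deriv (deriv g) u *\<^sub>R h1 v"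
proof -
  have first: "f differentiable (at s)" "g differentiable (at s)" if "s \<in> J" for s
    using assms(3,4) that by (auto simp: smooth_on_def dest!: spec[of _ 0])
  have second: "deriv f differentiable (at u)" "deriv g differentiable (at u)"
    using assms(2-4) by (auto simp: smooth_on_def dest!: spec[of _ 1])
  have "eventually (\<lambda>s. du (swept f g) s v = swept (deriv f) (deriv g) s v) (nhds u)"
    using eventually_nhds_in_open[OF J]
    by (rule eventually_mono) (simp add: du_swept first swept_def)
  then have "du (du (swept f g)) u v = du (swept (deriv f) (deriv g)) u v"
    unfolding du_def[of "du (swept f g)"] du_def[of "swept (deriv f) (deriv g)"]
    using J(2) by (intro vector_derivative_cong_eq) (auto dest: eventually_nhds_x_imp_x)
  then show ?thesis
    by (simp add: du_swept second)
qed

lemma first_fundamental_form_swept: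
  assumes "f differentiable (at u)" and "g differentiable (at u)"
  shows "coeffE (swept f g) u v = (deriv f u)\<^sup>2 - \<epsilon> * (deriv g u)\<^sup>2"
    and "coeffF (swept f g) u v = 0"
    and "coeffG (swept f g) u v = (\<alpha> * f u)\<^sup>2 + \<epsilon> * (\<beta> * g u)\<^sup>2"
  by (simp_all add: coeffE_def coeffF_def coeffG_def du_swept[OF assms] dv_swept
      lorentz_bilinear frame_products power2_eq_square algebra_simps)

text \<open>
  The purely algebraic part of the curvature computation. The left-hand side is the right-hand
  side of the Gauss equation with the scalar products of the frame inserted; the variables
  \<open>f1, f2, g1, g2\<close> stand for the derivatives of \<open>f\<close> and \<open>g\<close>. For each of the two values of \<open>\<epsilon>\<close>
  this is an identity of polynomials: the terms with second derivatives combine to a multiple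
  of \<open>f2 g1 - f1 g2\<close>, the others to a multiple of \<open>(g f1 - f g1)\<^sup>2\<close>, as in Lagrange's identity.
\<close>

lemma curvature_numerator:
  fixes a b f f1 f2 g g1 g2 :: real
  shows "(- a\<^sup>2 * f * f2 - \<epsilon> * b\<^sup>2 * g * g2 - ((a * f1)\<^sup>2 + \<epsilon> * (b * g1)\<^sup>2))
           * ((f1\<^sup>2 - \<epsilon> * g1\<^sup>2) * ((a * f)\<^sup>2 + \<epsilon> * (b * g)\<^sup>2))
         - (f1 * f2 - \<epsilon> * g1 * g2) * - (a\<^sup>2 * f * f1 + \<epsilon> * b\<^sup>2 * g * g1)
           * ((a * f)\<^sup>2 + \<epsilon> * (b * g)\<^sup>2)
         - - (a\<^sup>2 * f * f1 + \<epsilon> * b\<^sup>2 * g * g1)\<^sup>2 * (f1\<^sup>2 - \<epsilon> * g1\<^sup>2) =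
         a\<^sup>2 * b\<^sup>2 * (g * f1 - f * g1)\<^sup>2 * (- \<epsilon> * f1\<^sup>2 + g1\<^sup>2)
         + (\<epsilon> * (a * f)\<^sup>2 + (b * g)\<^sup>2) * (b\<^sup>2 * g * f1 + a\<^sup>2 * f * g1) * (f2 * g1 - f1 * g2)"
proof -
  have "\<epsilon> = 1 \<or> \<epsilon> = - 1"
    using sign_squared by (simp add: power2_eq_1_iff)
  then show ?thesis
  proof
    assume "\<epsilon> = 1"
    show ?thesis
      unfolding \<open>\<epsilon> = 1\<close> by (simp add: algebra_simps power2_eq_square)
  next
    assume "\<epsilon> = - 1"
    show ?thesis
      unfolding \<open>\<epsilon> = - 1\<close> by (simp add: algebra_simps power2_eq_square)
  qed
qed

text \<open>
  The polynomial is written with \<open>-\<epsilon> E = -\<epsilon> f'\<^sup>2 + g'\<^sup>2\<close> and \<open>\<epsilon> G = \<epsilon> (\<alpha> f)\<^sup>2 + (\<beta> g)\<^sup>2\<close> in place of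
  \<open>E\<close> and \<open>G\<close>; the two shapes agree because \<open>\<epsilon>\<^sup>2 = 1\<close>.
\<close>

lemma curvature_times_gram_squared:
  assumes J: "open J" "u \<in> J" and smooth: "smooth_on f J" "smooth_on g J"
    and E: "(deriv f u)\<^sup>2 - \<epsilon> * (deriv g u)\<^sup>2 \<noteq> 0"
    and G: "(\<alpha> * f u)\<^sup>2 + \<epsilon> * (\<beta> * g u)\<^sup>2 \<noteq> 0"
  shows "gaussian_curvature (swept f g) u v
           * (((\<alpha> * f u)\<^sup>2 + \<epsilon> * (\<beta> * g u)\<^sup>2)\<^sup>2 * (- \<epsilon> * (deriv f u)\<^sup>2 + (deriv g u)\<^sup>2)\<^sup>2) =
         \<alpha>\<^sup>2 * \<beta>\<^sup>2 * (g u * deriv f u - f u * deriv g u)\<^sup>2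
             * (- \<epsilon> * (deriv f u)\<^sup>2 + (deriv g u)\<^sup>2)
         + (\<epsilon> * (\<alpha> * f u)\<^sup>2 + (\<beta> * g u)\<^sup>2)
             * (\<beta>\<^sup>2 * g u * deriv f u + \<alpha>\<^sup>2 * f u * deriv g u)
             * (deriv (deriv f) u * deriv g u - deriv f u * deriv (deriv g) u)"
    (is "?K * (?G\<^sup>2 * ?E'\<^sup>2) = ?P")
proof -
  let ?X = "swept f g" and ?E = "(deriv f u)\<^sup>2 - \<epsilon> * (deriv g u)\<^sup>2"
  have diff: "f differentiable (at u)" "g differentiable (at u)"
    using smooth J(2) by (auto simp: smooth_on_def dest!: spec[of _ 0])
  note form = first_fundamental_form_swept[OF diff]
  note derivs = du_swept[OF diff] dv_swept dv_dv_swept dv_du_swept[OF diff]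
    du_du_swept[OF J smooth]
  have products:
    "lorentz (du (du ?X) u v) (dv (dv ?X) u v) =
       - \<alpha>\<^sup>2 * f u * deriv (deriv f) u - \<epsilon> * \<beta>\<^sup>2 * g u * deriv (deriv g) u"
    "lorentz (dv (du ?X) u v) (dv (du ?X) u v) = (\<alpha> * deriv f u)\<^sup>2 + \<epsilon> * (\<beta> * deriv g u)\<^sup>2"
    "lorentz (du (du ?X) u v) (du ?X u v) =
       deriv f u * deriv (deriv f) u - \<epsilon> * deriv g u * deriv (deriv g) u"
    "lorentz (dv (dv ?X) u v) (du ?X u v) =
       - (\<alpha>\<^sup>2 * f u * deriv f u + \<epsilon> * \<beta>\<^sup>2 * g u * deriv g u)"
    "lorentz (dv (du ?X) u v) (du ?X u v) = 0"
    "lorentz (du (du ?X) u v) (dv ?X u v) = 0"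
    "lorentz (dv (du ?X) u v) (dv ?X u v) =
       \<alpha>\<^sup>2 * f u * deriv f u + \<epsilon> * \<beta>\<^sup>2 * g u * deriv g u"
    by (simp_all add: derivs lorentz_bilinear frame_products power2_eq_square algebra_simps)
  have "?E' = - \<epsilon> * ?E"
    using sign_squared by algebra
  then have "?K * (?G\<^sup>2 * ?E'\<^sup>2) = ?K * (?E * ?G)\<^sup>2"
    using sign_squared by (simp add: power_mult_distrib)
  also have "\<dots> = ?P"
    using gaussian_curvature_orthogonal[of ?X u v] E G
    by (simp only: form products curvature_numerator[symmetric] zero_power2 mult_zero_left
        diff_0_right diff_0 simp_thms)
  finally show ?thesis .
qed

end


section \<open>The two types of rotational surface\<close>

lemma lorentz_axis:
  "lorentz (axis j 1) (axis k 1) = (if j = k then if j = 4 then - 1 else 1 else 0)"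
  using exhaust_4[of j] exhaust_4[of k] by (auto simp: lorentz_def axis_def)

lemma rotating_frame_hyperbola_spacelike:
  "rotating_frame (- 1) \<alpha> \<beta>
     (\<lambda>v. cos (\<alpha> * v) *\<^sub>R axis 1 1 + sin (\<alpha> * v) *\<^sub>R axis 2 1)
     (\<lambda>v. - sin (\<alpha> * v) *\<^sub>R axis 1 1 + cos (\<alpha> * v) *\<^sub>R axis 2 1)
     (\<lambda>v. cosh (\<beta> * v) *\<^sub>R axis 3 1 + sinh (\<beta> * v) *\<^sub>R axis 4 1)
     (\<lambda>v. sinh (\<beta> * v) *\<^sub>R axis 3 1 + cosh (\<beta> * v) *\<^sub>R axis 4 1)"
  by unfold_locales
    (auto intro!: derivative_eq_intros
      simp: lorentz_bilinear lorentz_axis scaleR_add_right scaleR_diff_right mult.commute cosh_square_eq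
      simp flip: power2_eq_square)

lemma rotating_frame_hyperbola_timelike:
  "rotating_frame 1 \<alpha> \<beta>
     (\<lambda>v. cos (\<alpha> * v) *\<^sub>R axis 1 1 + sin (\<alpha> * v) *\<^sub>R axis 2 1)
     (\<lambda>v. - sin (\<alpha> * v) *\<^sub>R axis 1 1 + cos (\<alpha> * v) *\<^sub>R axis 2 1)
     (\<lambda>v. sinh (\<beta> * v) *\<^sub>R axis 3 1 + cosh (\<beta> * v) *\<^sub>R axis 4 1)
     (\<lambda>v. cosh (\<beta> * v) *\<^sub>R axis 3 1 + sinh (\<beta> * v) *\<^sub>R axis 4 1)"
  by unfold_locales
    (auto intro!: derivative_eq_intros
      simp: lorentz_bilinear lorentz_axis scaleR_add_right scaleR_diff_right mult.commute cosh_square_eq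
      simp flip: power2_eq_square)

lemma vector_4:
  "(vector [x, y, z, t] :: real^4) =
     x *\<^sub>R axis 1 1 + y *\<^sub>R axis 2 1 + z *\<^sub>R axis 3 1 + t *\<^sub>R axis 4 1"
  by (simp add: vec_eq_iff forall_4 vector_def axis_def)

lemma rotational_surface_swept:
  assumes "i \<in> {1, 2}" and "\<epsilon> = (-1) ^ i"
  obtains e1 e2 h1 h2 where "rotating_frame \<epsilon> \<alpha> \<beta> e1 e2 h1 h2"
    and "\<And>f g. rotational_surface i \<alpha> \<beta> f g = rotating_frame.swept e1 h1 f g"
proof (cases "i = 1")
  case True
  then have "\<epsilon> = - 1"
    using assms by simp
  with True show thesis
    by (intro that[OF rotating_frame_hyperbola_spacelike[of \<alpha> \<beta>, folded \<open>\<epsilon> = - 1\<close>]])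
      (simp add: fun_eq_iff rotational_surface_def vector_4 scaleR_add_right add.assoc
        rotating_frame.swept_def[OF rotating_frame_hyperbola_spacelike[of \<alpha> \<beta>]])
next
  case False
  then have i: "i = 2" and "\<epsilon> = 1"
    using assms by simp_all
  with i show thesis
    by (intro that[OF rotating_frame_hyperbola_timelike[of \<alpha> \<beta>, folded \<open>\<epsilon> = 1\<close>]])
      (simp add: fun_eq_iff rotational_surface_def vector_4 scaleR_add_right add.assoc
        rotating_frame.swept_def[OF rotating_frame_hyperbola_timelike[of \<alpha> \<beta>]])
qed

lemma timelike_condition_nondegenerate:
  assumes "i \<in> {1, 2}" and "\<epsilon> = (-1) ^ i" and "timelike_condition i \<alpha> \<beta> f g J" and "u \<in> J"
  shows "(deriv f u)\<^sup>2 - \<epsilon> * (deriv g u)\<^sup>2 \<noteq> 0" and "(\<alpha> * f u)\<^sup>2 + \<epsilon> * (\<beta> * g u)\<^sup>2 \<noteq> 0"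
  using assms by (auto simp: timelike_condition_def power_mult_distrib dest!: bspec[of _ _ u])

theorem theorem6:
  fixes i :: nat
    and \<epsilon> \<alpha> \<beta> \<delta> l1 l2 l3 l4 :: real
    and f g :: "real \<Rightarrow> real"
    and J :: "real set"
  assumes "i \<in> {1, 2}"
    and "\<epsilon> = (-1) ^ i"
    and "\<alpha> > 0" and "\<beta> > 0"
    and "open J" and "is_interval J"
    and "smooth_on f J" and "smooth_on g J"
    and "timelike_condition i \<alpha> \<beta> f g J"
    and "\<not> (l1 = 0 \<and> l2 = 0 \<and> l3 = 0 \<and> l4 = 0)"
    and "\<delta> = l1 + l2 + l3 - l4"
  shows "weighted_flat (\<lambda>p. l1 * (p$1)\<^sup>2 + l2 * (p$2)\<^sup>2 + l3 * (p$3)\<^sup>2 + l4 * (p$4)\<^sup>2)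
           (rotational_surface i \<alpha> \<beta> f g) (J \<times> {0..<2 * pi}) \<longleftrightarrow>
         (\<forall>u\<in>J.
            - 2 * \<delta> * ((\<alpha> * f u)\<^sup>2 + \<epsilon> * (\<beta> * g u)\<^sup>2)\<^sup>2
                * (- \<epsilon> * (deriv f u)\<^sup>2 + (deriv g u)\<^sup>2)\<^sup>2
            + \<alpha>\<^sup>2 * \<beta>\<^sup>2 * (g u * deriv f u - f u * deriv g u)\<^sup>2
                * (- \<epsilon> * (deriv f u)\<^sup>2 + (deriv g u)\<^sup>2)
            + (\<epsilon> * (\<alpha> * f u)\<^sup>2 + (\<beta> * g u)\<^sup>2)
                * (\<beta>\<^sup>2 * g u * deriv f u + \<alpha>\<^sup>2 * f u * deriv g u)
                * (deriv (deriv f) u * deriv g u - deriv f u * deriv (deriv g) u) = 0)"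
proof -
  obtain e1 e2 h1 h2 where frame: "rotating_frame \<epsilon> \<alpha> \<beta> e1 e2 h1 h2"
    and X: "\<And>f g. rotational_surface i \<alpha> \<beta> f g = rotating_frame.swept e1 h1 f g"
    using rotational_surface_swept[OF assms(1,2)] by metis
  let ?X = "rotational_surface i \<alpha> \<beta> f g"
  let ?\<phi> = "\<lambda>p::real^4. l1 * (p$1)\<^sup>2 + l2 * (p$2)\<^sup>2 + l3 * (p$3)\<^sup>2 + l4 * (p$4)\<^sup>2"
  let ?N = "\<lambda>u. ((\<alpha> * f u)\<^sup>2 + \<epsilon> * (\<beta> * g u)\<^sup>2)\<^sup>2 * (- \<epsilon> * (deriv f u)\<^sup>2 + (deriv g u)\<^sup>2)\<^sup>2"
  let ?P = "\<lambda>u. \<alpha>\<^sup>2 * \<beta>\<^sup>2 * (g u * deriv f u - f u * deriv g u)\<^sup>2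
                * (- \<epsilon> * (deriv f u)\<^sup>2 + (deriv g u)\<^sup>2)
            + (\<epsilon> * (\<alpha> * f u)\<^sup>2 + (\<beta> * g u)\<^sup>2)
                * (\<beta>\<^sup>2 * g u * deriv f u + \<alpha>\<^sup>2 * f u * deriv g u)
                * (deriv (deriv f) u * deriv g u - deriv f u * deriv (deriv g) u)"
  have pointwise: "weighted_gaussian_curvature ?\<phi> ?X u v = 0 \<longleftrightarrow> - 2 * \<delta> * ?N u + ?P u = 0"
    if "u \<in> J" for u v
  proof -
    note nondeg = timelike_condition_nondegenerate[OF assms(1,2,9) that]
    have "\<epsilon>\<^sup>2 = 1"
      using frame by (rule rotating_frame.sign_squared)
    then have "- \<epsilon> * (deriv f u)\<^sup>2 + (deriv g u)\<^sup>2 = - \<epsilon> * ((deriv f u)\<^sup>2 - \<epsilon> * (deriv g u)\<^sup>2)"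
      by algebra
    moreover have "\<epsilon> \<noteq> 0"
      using \<open>\<epsilon>\<^sup>2 = 1\<close> by auto
    ultimately have "?N u \<noteq> 0"
      using nondeg by simp
    have "weighted_gaussian_curvature ?\<phi> ?X u v = gaussian_curvature ?X u v - 2 * \<delta>"
      by (simp add: weighted_gaussian_curvature_def laplacian_diagonal_quadratic assms(11))
    moreover have "gaussian_curvature ?X u v * ?N u = ?P u"
      unfolding X
      using rotating_frame.curvature_times_gram_squared
        [OF frame assms(5) that assms(7,8) nondeg] .
    ultimately have "weighted_gaussian_curvature ?\<phi> ?X u v * ?N u = - 2 * \<delta> * ?N u + ?P u"
      by (simp only: left_diff_distrib)
    moreover have "w = 0 \<longleftrightarrow> r = 0" if "w * n = r" "n \<noteq> 0" for w n r :: real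
      using that by auto
    ultimately show ?thesis
      using \<open>?N u \<noteq> 0\<close> by blast
  qed
  \<comment> \<open>The right-hand side is independent of \<open>v\<close>, and \<open>v = 0\<close> lies in the parameter domain.\<close>
  have "(0::real) \<in> {0..<2 * pi}"
    by simp
  then have "weighted_flat ?\<phi> ?X (J \<times> {0..<2 * pi}) \<longleftrightarrow> (\<forall>u\<in>J. - 2 * \<delta> * ?N u + ?P u = 0)"
    unfolding weighted_flat_def using pointwise by blast
  then show ?thesis
    by (simp only: mult.assoc add.assoc)
qed

end
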